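(* Let $D\subseteq\mathbb{R}$ be an interval, let $G$ be a Hilbert space of functions $g:D\to\mathbb{R}$ endowed with a zero-mean probability measure $\mu$ with covariance kernel $K_\mu^{\rm cov}(x,y)=\int_G g(x)\,g(y)\,\mu(\mathrm{d}g)$, let $\omega$ be a probability measure on $\mathbb{R}$, and let $(\xi_j)_{j\ge1}$ be real numbers with $\sum_{j=1}^\infty|\xi_j|<\infty$. For $\boldsymbol{x}=(x_j)_{j\ge 1}$ put $Y_k(\boldsymbol{x})=\sum_{j=1}^k x_j\xi_j$ and $Y_\infty(\boldsymbol{x})=\sum_{j=1}^\infty x_j\xi_j$. Define $$e_1^{\rm trnc}(k;K_\mu^{\rm cov},\omega)=\left[\int_G\left(\int_{\mathbb{R}^{\mathbb{N}}}\big(g(Y_\infty(\boldsymbol{x}))-g(Y_k(\boldsymbol{x}))\big)\,\omega^{\mathbb{N}}(\mathrm{d}\boldsymbol{x})\right)^2\mu(\mathrm{d}g)\right]^{1/2},$$ $$e_2^{\rm trnc}(k;K_\mu^{\rm cov},\omega)=\left[\int_{\mathbb{R}^{\mathbb{N}}}\int_G\big(g(Y_\infty(\boldsymbol{x}))-g(Y_k(\boldsymbol{x}))\big)^2\,\mu(\mathrm{d}g)\,\omega^{\mathbb{N}}(\mathrm{d}\boldsymbol{x})\right]^{1/2}.$$ Assume that Fubini's theorem holds. Then $$e_1^{\rm trnc}(k;K_\mu^{\rm cov},\omega)=\left[\int_{\mathbb{R}^{\mathbb{N}}}\int_{\mathbb{R}^{\mathbb{N}}}\Big(K_\mu^{\rm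 cov}(Y_\infty(\boldsymbol{x}),Y_\infty(\boldsymbol{z}))-2K_\mu^{\rm cov}(Y_\infty(\boldsymbol{x}),Y_k(\boldsymbol{z}))+K_\mu^{\rm cov}(Y_k(\boldsymbol{x}),Y_k(\boldsymbol{z}))\Big)\omega^{\mathbb{N}}(\mathrm{d}\boldsymbol{z})\,\omega^{\mathbb{N}}(\mathrm{d}\boldsymbol{x})\right]^{1/2}$$ and $$e_2^{\rm trnc}(k;K_\mu^{\rm cov},\omega)=\left[\int_{\mathbb{R}^{\mathbb{N}}}\Big(K_\mu^{\rm cov}(Y_\infty(\boldsymbol{x}),Y_\infty(\boldsymbol{x}))-2K_\mu^{\rm cov}(Y_\infty(\boldsymbol{x}),Y_k(\boldsymbol{x}))+K_\mu^{\rm cov}(Y_k(\boldsymbol{x}),Y_k(\boldsymbol{x}))\Big)\omega^{\mathbb{N}}(\mathrm{d}\boldsymbol{x})\right]^{1/2}.$$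
   Context: $\omega^{\mathbb{N}}$ is the countable product measure on $\mathbb{R}^{\mathbb{N}}$, i.e. the coordinates $x_j$ are i.i.d. with law $\omega$. It is understood that $Y_\infty$ converges and that $Y_k,Y_\infty$ take values in $D$ for $\omega^{\mathbb{N}}$-almost every $\boldsymbol{x}$. "Fubini's theorem holds" means $\mathbb{E}_\mu\mathbb{E}_{\omega^{\mathbb{N}}}=\mathbb{E}_{\omega^{\mathbb{N}}}\mathbb{E}_\mu$: integration over $G$ with respect to $\mu$ and integration with respect to $\omega^{\mathbb{N}}$ (in one variable $\boldsymbol{x}$, or iterated in two variables $\boldsymbol{x},\boldsymbol{z}$) may be interchanged for the integrands that occur, namely the products $g(U)g(V)$ with $U,V\in\{Y_\infty,Y_k\}$ evaluated at the same or at different points $\boldsymbol{x},\boldsymbol{z}$; all integrands are assumed measurable and integrable. *)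

theory Defs
  imports "HOL-Probability.Probability"
begin

text \<open>
  Functions \<open>g : D \<rightarrow> \<real>\<close> are the elements of \<^term>\<open>extensional D\<close>, so the pointwise operations
  are restricted to \<^term>\<open>D\<close>.
\<close>

locale hilbert_function_space =
  fixes D :: "real set"
    and G :: "(real \<Rightarrow> real) set"
    and ip :: "(real \<Rightarrow> real) \<Rightarrow> (real \<Rightarrow> real) \<Rightarrow> real"
  assumes functions_on: "G \<subseteq> extensional D"
    and zero_mem: "(\<lambda>t\<in>D. 0) \<in> G"
    and add_mem: "\<lbrakk>f \<in> G; g \<in> G\<rbrakk> \<Longrightarrow> (\<lambda>t\<in>D. f t + g t) \<in> G"
    and scale_mem: "f \<in> G \<Longrightarrow> (\<lambda>t\<in>D. c * f t) \<in> G"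
    and ip_commute: "\<lbrakk>f \<in> G; g \<in> G\<rbrakk> \<Longrightarrow> ip f g = ip g f"
    and ip_add: "\<lbrakk>f \<in> G; g \<in> G; h \<in> G\<rbrakk> \<Longrightarrow> ip (\<lambda>t\<in>D. f t + g t) h = ip f h + ip g h"
    and ip_scale: "\<lbrakk>f \<in> G; g \<in> G\<rbrakk> \<Longrightarrow> ip (\<lambda>t\<in>D. c * f t) g = c * ip f g"
    and ip_nonneg: "f \<in> G \<Longrightarrow> 0 \<le> ip f f"
    and ip_definite: "\<lbrakk>f \<in> G; ip f f = 0\<rbrakk> \<Longrightarrow> f = (\<lambda>t\<in>D. 0)"
    and complete:
      "Metric_space.mcomplete G
         (\<lambda>f g. sqrt (ip (\<lambda>t\<in>D. f t - g t) (\<lambda>t\<in>D. f t - g t)))"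

text \<open>
  The \<open>\<sigma>\<close>-algebra on \<^term>\<open>G\<close> is arbitrary, subject to the point evaluations having the moments
  below. The last assumption says that the covariance kernel exists on \<open>D \<times> D\<close>.
\<close>

locale zero_mean_measure = prob_space \<mu>
  for D :: "real set" and G :: "(real \<Rightarrow> real) set" and \<mu> :: "(real \<Rightarrow> real) measure" +
  assumes space_eq: "space \<mu> = G"
    and integrable_eval: "t \<in> D \<Longrightarrow> integrable \<mu> (\<lambda>g. g t)"
    and mean_zero: "t \<in> D \<Longrightarrow> (\<integral>g. g t \<partial>\<mu>) = 0"
    and integrable_eval_mult: "\<lbrakk>s \<in> D; t \<in> D\<rbrakk> \<Longrightarrow> integrable \<mu> (\<lambda>g. g s * g t)"

definition Kcov :: "(real \<Rightarrow> real) measure \<Rightarrow> real \<Rightarrow> real \<Rightarrow> real" where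
  "Kcov \<mu> s t = (\<integral>g. g s * g t \<partial>\<mu>)"

text \<open>Coordinates are numbered from \<open>0\<close>: \<^term>\<open>x j\<close> and \<^term>\<open>\<xi> j\<close> stand for \<open>x\<^bsub>j+1\<^esub>\<close> and \<open>\<xi>\<^bsub>j+1\<^esub>\<close>.\<close>

definition seq_measure :: "real measure \<Rightarrow> (nat \<Rightarrow> real) measure" where
  "seq_measure \<omega> = Pi\<^sub>M UNIV (\<lambda>_. \<omega>)"

definition Y :: "(nat \<Rightarrow> real) \<Rightarrow> nat \<Rightarrow> (nat \<Rightarrow> real) \<Rightarrow> real" where
  "Y \<xi> k x = (\<Sum>j<k. x j * \<xi> j)"

definition Yinf :: "(nat \<Rightarrow> real) \<Rightarrow> (nat \<Rightarrow> real) \<Rightarrow> real" where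
  "Yinf \<xi> x = (\<Sum>j. x j * \<xi> j)"

definition e1_trnc ::
    "(real \<Rightarrow> real) measure \<Rightarrow> real measure \<Rightarrow> (nat \<Rightarrow> real) \<Rightarrow> nat \<Rightarrow> real" where
  "e1_trnc \<mu> \<omega> \<xi> k =
     sqrt (\<integral>g. (\<integral>x. (g (Yinf \<xi> x) - g (Y \<xi> k x)) \<partial>seq_measure \<omega>)\<^sup>2 \<partial>\<mu>)"

definition e2_trnc ::
    "(real \<Rightarrow> real) measure \<Rightarrow> real measure \<Rightarrow> (nat \<Rightarrow> real) \<Rightarrow> nat \<Rightarrow> real" where
  "e2_trnc \<mu> \<omega> \<xi> k =
     sqrt (\<integral>x. (\<integral>g. (g (Yinf \<xi> x) - g (Y \<xi> k x))\<^sup>2 \<partial>\<mu>) \<partial>seq_measure \<omega>)"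

definition iterated_integrable ::
    "'a measure \<Rightarrow> 'b measure \<Rightarrow> ('a \<Rightarrow> 'b \<Rightarrow> real) \<Rightarrow> bool" where
  "iterated_integrable M N f \<longleftrightarrow>
     (AE x in M. integrable N (f x)) \<and> integrable M (\<lambda>x. \<integral>y. f x y \<partial>N)"

definition interchangeable ::
    "'a measure \<Rightarrow> 'b measure \<Rightarrow> ('a \<Rightarrow> 'b \<Rightarrow> real) \<Rightarrow> bool" where
  "interchangeable M N f \<longleftrightarrow>
     iterated_integrable M N f \<and> iterated_integrable N M (\<lambda>y x. f x y) \<and>
     (\<integral>x. (\<integral>y. f x y \<partial>N) \<partial>M) = (\<integral>y. (\<integral>x. f x y \<partial>M) \<partial>N)"

text \<open>
  The assumption that Fubini's theorem holds for the products of \<open>g (U _)\<close> and \<open>g (V _)\<close>, taken at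
  the same or at two different points, where \<open>U\<close> and \<open>V\<close> range over \<open>S\<close>.
\<close>

definition fubini_holds ::
    "(real \<Rightarrow> real) measure \<Rightarrow> 'x measure \<Rightarrow> ('x \<Rightarrow> real) set \<Rightarrow> bool" where
  "fubini_holds \<mu> P S \<longleftrightarrow>
     (\<forall>U\<in>S. (\<lambda>(g, x). g (U x)) \<in> borel_measurable (\<mu> \<Otimes>\<^sub>M P)) \<and>
     (\<forall>U\<in>S. \<forall>V\<in>S.
        interchangeable \<mu> P (\<lambda>g x. g (U x) * g (V x)) \<and>
        interchangeable \<mu> (P \<Otimes>\<^sub>M P) (\<lambda>g (x, z). g (U x) * g (V z)))"

end

theory Submission
  imports Defs
begin

text \<open>Both radicands are quadratic in \<open>g\<close>, and the \<open>\<mu>\<close>-mean of a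
  product of two values of \<open>g\<close> is the kernel by definition. For the first error, the
  square of an integral over x becomes a double integral over independent copies x and z; the
  expanded square is integrated over \<open>\<mu>\<close> term by term and the two integrations are
  interchanged (\<open>integral_square_diff_swap_pair\<close>). For the second error the square is
  expanded at a fixed point x, where linearity of the \<open>\<mu>\<close>-integral suffices
  (\<open>integral_square_diff_swap_diagonal\<close>). Both lemmas treat two general maps
  \<open>U\<close>, \<open>V\<close> into the reals.\<close>

lemma (in pair_sigma_finite) integral_tensor:
  fixes f :: "'a \<Rightarrow> real" and h :: "'b \<Rightarrow> real"
  assumes f: "integrable M1 f" and h: "integrable M2 h"
  shows "(\<integral>(x, z). f x * h z \<partial>(M1 \<Otimes>\<^sub>M M2)) = (\<integral>x. f x \<partial>M1) * (\<integral>z. h z \<partial>M2)"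
proof -
  have [measurable]: "f \<in> borel_measurable M1" "h \<in> borel_measurable M2"
    using f h by auto
  \<comment> \<open>Tonelli: the absolute value factors as well, so its iterated integral is
    finite.\<close>
  have "integrable (M1 \<Otimes>\<^sub>M M2) (\<lambda>(x, z). f x * h z)"
    using f h by (intro Fubini_integrable) (auto simp: abs_mult)
  from integral_fst'[OF this] show ?thesis
    by simp
qed

text \<open>For almost every \<open>g\<close> the square is a combination of products of two single
  integrals, and each product is an integral over \<open>P \<Otimes>\<^sub>M P\<close>. The
  two-point case of \<open>fubini_holds\<close> then moves the \<open>\<mu>\<close>-integral inside,
  where it produces \<open>Kcov\<close>.\<close>

lemma integral_square_diff_swap_pair:
  fixes \<mu> :: "(real \<Rightarrow> real) measure" and P :: "'x measure"
  assumes "prob_space \<mu>" and "prob_space P" and fub: "fubini_holds \<mu> P {U, V}"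
  shows "(\<integral>g. (\<integral>x. (g (U x) - g (V x)) \<partial>P)\<^sup>2 \<partial>\<mu>) =
    (\<integral>x. (\<integral>z. (Kcov \<mu> (U x) (U z) - 2 * Kcov \<mu> (U x) (V z) + Kcov \<mu> (V x) (V z)) \<partial>P) \<partial>P)"
proof -
  interpret M: prob_space \<mu> by fact
  interpret P: prob_space P by fact
  interpret PP: pair_prob_space P P ..
  have meas: "(\<lambda>(g, x). g (A x)) \<in> borel_measurable (\<mu> \<Otimes>\<^sub>M P)" if "A \<in> {U, V}" for A
    using fub that unfolding fubini_holds_def by blast
  \<comment> \<open>\<open>J A B g\<close> is the product of the \<open>P\<close>-means of
    \<open>g (A x)\<close> and \<open>g (B x)\<close>, written as one double integral so that the
    interchange hypothesis applies to it.\<close>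
  define J where "J A B g = (\<integral>(x, z). g (A x) * g (B z) \<partial>(P \<Otimes>\<^sub>M P))"
    for A B :: "'x \<Rightarrow> real" and g :: "real \<Rightarrow> real"
  have J: "integrable \<mu> (J A B)"
    and K: "integrable (P \<Otimes>\<^sub>M P) (\<lambda>(x, z). Kcov \<mu> (A x) (B z))"
    and JK: "(\<integral>g. J A B g \<partial>\<mu>) = (\<integral>(x, z). Kcov \<mu> (A x) (B z) \<partial>(P \<Otimes>\<^sub>M P))"
    if "A \<in> {U, V}" "B \<in> {U, V}" for A B
  proof -
    have "interchangeable \<mu> (P \<Otimes>\<^sub>M P) (\<lambda>g (x, z). g (A x) * g (B z))"
      using fub that unfolding fubini_holds_def by blast
    then show "integrable \<mu> (J A B)"
      "integrable (P \<Otimes>\<^sub>M P) (\<lambda>(x, z). Kcov \<mu> (A x) (B z))"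
      "(\<integral>g. J A B g \<partial>\<mu>) = (\<integral>(x, z). Kcov \<mu> (A x) (B z) \<partial>(P \<Otimes>\<^sub>M P))"
      by (simp_all add: interchangeable_def iterated_integrable_def J_def[abs_def] Kcov_def split_beta')
  qed
  \<comment> \<open>The hypothesis speaks only of products. Taking both factors equal at the same
    point gives square integrability, which implies integrability on a probability space.\<close>
  have int: "AE g in \<mu>. integrable P (\<lambda>x. g (A x))" if A: "A \<in> {U, V}" for A
  proof -
    have "interchangeable \<mu> P (\<lambda>g x. g (A x) * g (A x))"
      using fub A unfolding fubini_holds_def by blast
    then have "AE g in \<mu>. integrable P (\<lambda>x. g (A x) * g (A x))"
      by (simp add: interchangeable_def iterated_integrable_def)
    with AE_space show ?thesis
    proof eventually_elim
      case (elim g)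
      have "(\<lambda>x. g (A x)) \<in> borel_measurable P"
        using measurable_Pair2[OF meas[OF A] elim(1)] by simp
      from P.square_integrable_imp_integrable[OF this] elim(2) show ?case
        by (simp add: power2_eq_square)
    qed
  qed
  \<comment> \<open>The mixed terms merge into \<open>2 * J U V g\<close> because both equal the
    same product of two real numbers; symmetry of the kernel is not invoked.\<close>
  have "AE g in \<mu>. (\<integral>x. (g (U x) - g (V x)) \<partial>P)\<^sup>2 = J U U g - 2 * J U V g + J V V g"
    using int[of U, simplified] int[of V, simplified]
  proof eventually_elim
    case (elim g)
    then show ?case
      by (simp add: J_def PP.integral_tensor power2_eq_square algebra_simps)
  qed
  \<comment> \<open>The identity above holds only almost everywhere, so
    \<open>integral_cong_AE\<close> also asks for measurability of the left side; it comes from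
    joint measurability in g and x.\<close>
  moreover have "(\<lambda>g. (\<integral>x. (g (U x) - g (V x)) \<partial>P)\<^sup>2) \<in> borel_measurable \<mu>"
    using borel_measurable_diff[OF meas[of U] meas[of V]]
    by (intro borel_measurable_power P.borel_measurable_lebesgue_integral) (simp add: split_beta')
  ultimately have "(\<integral>g. (\<integral>x. (g (U x) - g (V x)) \<partial>P)\<^sup>2 \<partial>\<mu>) =
      (\<integral>g. (J U U g - 2 * J U V g + J V V g) \<partial>\<mu>)"
    using J by (intro integral_cong_AE) simp_all
  also have "\<dots> = (\<integral>g. J U U g \<partial>\<mu>) - 2 * (\<integral>g. J U V g \<partial>\<mu>) + (\<integral>g. J V V g \<partial>\<mu>)"
    using J by simp
  also have "\<dots> = (\<integral>(x, z). (Kcov \<mu> (U x) (U z) - 2 * Kcov \<mu> (U x) (V z) + Kcov \<mu> (V x) (V z)) \<partial>(P \<Otimes>\<^sub>M P))"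
    using K by (simp add: JK split_beta')
  also have "\<dots> = (\<integral>x. (\<integral>z. (Kcov \<mu> (U x) (U z) - 2 * Kcov \<mu> (U x) (V z) + Kcov \<mu> (V x) (V z)) \<partial>P) \<partial>P)"
    using K by (intro PP.integral_fst[symmetric]) (simp add: split_beta')
  finally show ?thesis .
qed

text \<open>Here the \<open>\<mu>\<close>-integral is already the inner one, so the two integrands
  agree at almost every x. The hypothesis \<open>fubini_holds\<close> supplies the measurability in
  x that an almost-everywhere comparison requires.\<close>

lemma integral_square_diff_swap_diagonal:
  fixes \<mu> :: "(real \<Rightarrow> real) measure" and P :: "'x measure"
  assumes "zero_mean_measure D G \<mu>" and "prob_space P" and fub: "fubini_holds \<mu> P {U, V}"
    and D: "AE x in P. U x \<in> D \<and> V x \<in> D"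
  shows "(\<integral>x. (\<integral>g. (g (U x) - g (V x))\<^sup>2 \<partial>\<mu>) \<partial>P) =
    (\<integral>x. (Kcov \<mu> (U x) (U x) - 2 * Kcov \<mu> (U x) (V x) + Kcov \<mu> (V x) (V x)) \<partial>P)"
proof (rule integral_cong_AE)
  interpret M: zero_mean_measure D G \<mu> by fact
  interpret P: prob_space P by fact
  have meas: "(\<lambda>(x, g). g (A x)) \<in> borel_measurable (P \<Otimes>\<^sub>M \<mu>)" if "A \<in> {U, V}" for A
  proof -
    have "(\<lambda>(g, x). g (A x)) \<in> borel_measurable (\<mu> \<Otimes>\<^sub>M P)"
      using fub that unfolding fubini_holds_def by blast
    \<comment> \<open>The factors are swapped because the inner integration is now over g, with x as
      the parameter.\<close>
    from measurable_pair_swap[OF this] show ?thesis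
      by simp
  qed
  show "(\<lambda>x. \<integral>g. (g (U x) - g (V x))\<^sup>2 \<partial>\<mu>) \<in> borel_measurable P"
    using borel_measurable_power[OF borel_measurable_diff[OF meas[of U] meas[of V]], of 2]
    by (intro M.borel_measurable_lebesgue_integral) (simp add: split_beta')
  have "integrable P (\<lambda>x. Kcov \<mu> (A x) (B x))" if "A \<in> {U, V}" "B \<in> {U, V}" for A B
  proof -
    have "interchangeable \<mu> P (\<lambda>g x. g (A x) * g (B x))"
      using fub that unfolding fubini_holds_def by blast
    then show ?thesis
      by (simp add: interchangeable_def iterated_integrable_def Kcov_def)
  qed
  then show "(\<lambda>x. Kcov \<mu> (U x) (U x) - 2 * Kcov \<mu> (U x) (V x) + Kcov \<mu> (V x) (V x)) \<in> borel_measurable P"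
    by (intro borel_measurable_integrable) simp
  show "AE x in P. (\<integral>g. (g (U x) - g (V x))\<^sup>2 \<partial>\<mu>) =
      Kcov \<mu> (U x) (U x) - 2 * Kcov \<mu> (U x) (V x) + Kcov \<mu> (V x) (V x)"
    using D
  proof eventually_elim
    case (elim x)
    have "(\<integral>g. (g (U x) - g (V x))\<^sup>2 \<partial>\<mu>) =
        (\<integral>g. (g (U x) * g (U x) - 2 * (g (U x) * g (V x)) + g (V x) * g (V x)) \<partial>\<mu>)"
      by (simp add: power2_eq_square algebra_simps)
    \<comment> \<open>Splitting the integral needs each product to be
      \<open>\<mu>\<close>-integrable, which is known at points of \<open>D\<close>; hence the
      restriction to almost every x.\<close>
    also have "\<dots> = Kcov \<mu> (U x) (U x) - 2 * Kcov \<mu> (U x) (V x) + Kcov \<mu> (V x) (V x)"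
      using elim M.integrable_eval_mult by (simp add: Kcov_def)
    finally show ?case .
  qed
qed

theorem proposition2:
  fixes D :: "real set"
    and G :: "(real \<Rightarrow> real) set"
    and ip :: "(real \<Rightarrow> real) \<Rightarrow> (real \<Rightarrow> real) \<Rightarrow> real"
    and \<mu> :: "(real \<Rightarrow> real) measure"
    and \<omega> :: "real measure"
    and \<xi> :: "nat \<Rightarrow> real"
    and k :: nat
  assumes "is_interval D"
    and "hilbert_function_space D G ip"
    and "zero_mean_measure D G \<mu>"
    and "prob_space \<omega>" and "sets \<omega> = sets borel"
    and "summable (\<lambda>j. \<bar>\<xi> j\<bar>)"
    and "AE x in seq_measure \<omega>. summable (\<lambda>j. x j * \<xi> j) \<and> Yinf \<xi> x \<in> D \<and> Y \<xi> k x \<in> D"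
    and "fubini_holds \<mu> (seq_measure \<omega>) {Yinf \<xi>, Y \<xi> k}"
  shows "e1_trnc \<mu> \<omega> \<xi> k =
           sqrt (\<integral>x. (\<integral>z. (Kcov \<mu> (Yinf \<xi> x) (Yinf \<xi> z) - 2 * Kcov \<mu> (Yinf \<xi> x) (Y \<xi> k z)
                              + Kcov \<mu> (Y \<xi> k x) (Y \<xi> k z)) \<partial>seq_measure \<omega>) \<partial>seq_measure \<omega>)
       \<and> e2_trnc \<mu> \<omega> \<xi> k =
           sqrt (\<integral>x. (Kcov \<mu> (Yinf \<xi> x) (Yinf \<xi> x) - 2 * Kcov \<mu> (Yinf \<xi> x) (Y \<xi> k x)
                              + Kcov \<mu> (Y \<xi> k x) (Y \<xi> k x)) \<partial>seq_measure \<omega>)"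
proof -
  interpret W: prob_space \<omega> by fact
  have P: "prob_space (seq_measure \<omega>)"
    unfolding seq_measure_def by (intro prob_space_PiM W.prob_space_axioms)
  have \<mu>: "prob_space \<mu>"
    using assms(3) by (rule zero_mean_measure.axioms)
  have D: "AE x in seq_measure \<omega>. Yinf \<xi> x \<in> D \<and> Y \<xi> k x \<in> D"
    using assms(7) by eventually_elim blast
  show ?thesis
    unfolding e1_trnc_def e2_trnc_def
    \<comment> \<open>With \<open>U\<close> as \<open>Yinf \<xi>\<close> and \<open>V\<close> as
      \<open>Y \<xi> k\<close>, the two lemmas equate the radicands.\<close>
    using integral_square_diff_swap_pair[OF \<mu> P assms(8)]
      integral_square_diff_swap_diagonal[OF assms(3) P assms(8) D]
    by simp
qed

end
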